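(* For $\tilde r\in\widetilde{\mathbb{C}}(n)$ the following assertions are equivalent. (i) $\tilde r$ is not invertible. (ii) $\tilde r$ has a representative $r$ such that for all $q\in\mathbb{N}$ there is some $\varphi_q\in\mathcal{A}_q(\mathbb{R}^n)$ and a strictly decreasing sequence $(\varepsilon_{q,k})_{k\in\mathbb{N}}$ of positive reals converging to $0$ such that $r(S_{\varepsilon_{q,k}}\varphi_q)=0$ for all $k\in\mathbb{N}$. (iii) $\tilde r$ is a zero divisor.
   Context: $n\in\mathbb{N}=\{1,2,\dots\}$. For expressions defined for small $\varepsilon>0$, $f(\varepsilon)=O(g(\varepsilon))$ means $\exists C>0\ \exists\varepsilon_0>0\ \forall\varepsilon<\varepsilon_0$: $|f(\varepsilon)|<C|g(\varepsilon)|$. $\mathcal{D}(\mathbb{R}^n)$ is the space of smooth compactly supported (complex-valued) functions. For $q\in\mathbb{N}_0$, $\mathcal{A}_q(\mathbb{R}^n)$ is the set of $\varphi\in\mathcal{D}(\mathbb{R}^n)$ with $\int\varphi=1$ and $\int x^\alpha\varphi(x)\,dx=0$ for all multi-indices $\alpha$ with $1\le|\alpha|\le q$. For $\varepsilon>0$, $(S_\varepsilon\varphi)(y):=\varepsilon^{-n}\varphi(y/\varepsilon)$. $\mathbb{C}_M(n)$ is the set of $r:\mathcal{A}_0(\mathbb{R}^n)\to\mathbb{C}$ such that $\exists N\in\mathbb{N}\ \forall\varphi\in\mathcal{A}_N(\mathbb{R}^n)$: $|r(S_\varepsilon\varphi)|=O(\varepsilon^{-N})$; $\mathbb{C}_N(n)$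 is the set of $r:\mathcal{A}_0(\mathbb{R}^n)\to\mathbb{C}$ such that $\forall m\in\mathbb{N}\ \exists q\in\mathbb{N}\ \forall\varphi\in\mathcal{A}_q(\mathbb{R}^n)$: $|r(S_\varepsilon\varphi)|=O(\varepsilon^m)$; $\widetilde{\mathbb{C}}(n):=\mathbb{C}_M(n)/\mathbb{C}_N(n)$ with pointwise operations. A zero divisor is an element $\tilde r$ for which there is $\tilde s\neq0$ with $\tilde r\tilde s=0$ (so $0$ counts as a zero divisor). *)

theory Defs
  imports "HOL-Analysis.Analysis" "HOL-Algebra.QuotRing" "HOL-Library.Landau_Symbols"
begin

text \<open>
  The number \<open>n \<ge> 1\<close> is the cardinality of the index type \<open>'n\<close>, and \<open>\<real>\<^sup>n\<close> is \<open>real ^ 'n\<close>.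
\<close>

text \<open>
  A function is \<open>C\<^sup>k\<^sup>+\<^sup>1\<close> iff it is (totally) differentiable and its first-order partial
  derivatives are \<open>C\<^sup>k\<close>.
\<close>

primrec C_k :: "nat \<Rightarrow> (real ^ 'n \<Rightarrow> complex) \<Rightarrow> bool" where
  "C_k 0 f \<longleftrightarrow> continuous_on UNIV f"
| "C_k (Suc k) f \<longleftrightarrow>
     (\<forall>x. f differentiable (at x)) \<and>
     (\<forall>i. C_k k (\<lambda>x. frechet_derivative f (at x) (axis i 1)))"

definition smooth :: "(real ^ 'n \<Rightarrow> complex) \<Rightarrow> bool" where
  "smooth f \<longleftrightarrow> (\<forall>k. C_k k f)"

definition test_fun :: "(real ^ 'n \<Rightarrow> complex) set" where
  "test_fun = {\<phi>. smooth \<phi> \<and> compact (closure {x. \<phi> x \<noteq> 0})}"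

definition monomial :: "('n::finite \<Rightarrow> nat) \<Rightarrow> real ^ 'n \<Rightarrow> real" where
  "monomial \<alpha> x = (\<Prod>i\<in>UNIV. (x $ i) ^ \<alpha> i)"

definition \<A> :: "nat \<Rightarrow> (real ^ 'n \<Rightarrow> complex) set" where
  "\<A> q = {\<phi> \<in> test_fun. (LINT x|lborel. \<phi> x) = 1 \<and>
     (\<forall>\<alpha>. 1 \<le> (\<Sum>i\<in>UNIV. \<alpha> i) \<and> (\<Sum>i\<in>UNIV. \<alpha> i) \<le> q \<longrightarrow>
        (LINT x|lborel. of_real (monomial \<alpha> x) * \<phi> x) = 0)}"

definition dilate :: "real \<Rightarrow> (real ^ 'n \<Rightarrow> complex) \<Rightarrow> real ^ 'n \<Rightarrow> complex" where
  "dilate \<epsilon> \<phi> = (\<lambda>y. of_real (\<epsilon> powi (- int CARD('n))) * \<phi> ((1 / \<epsilon>) *\<^sub>R y))"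

text \<open>
  Maps \<open>\<A> 0 \<rightarrow> \<complex>\<close> are represented extensionally, i.e. as total functions that are
  \<open>undefined\<close> outside \<open>\<A> 0\<close>, so that equality of such maps is equality in HOL.
  Only the scales \<open>\<epsilon> > 0\<close> matter, hence the filter \<open>at_right 0\<close>.
\<close>

definition C_mod :: "((real ^ 'n \<Rightarrow> complex) \<Rightarrow> complex) set" where
  "C_mod = {r \<in> \<A> 0 \<rightarrow>\<^sub>E UNIV. \<exists>N\<ge>1. \<forall>\<phi>\<in>\<A> N.
     (\<lambda>\<epsilon>. cmod (r (dilate \<epsilon> \<phi>))) \<in> O[at_right 0](\<lambda>\<epsilon>. \<epsilon> powi (- int N))}"

definition C_null :: "((real ^ 'n \<Rightarrow> complex) \<Rightarrow> complex) set" where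
  "C_null = {r \<in> \<A> 0 \<rightarrow>\<^sub>E UNIV. \<forall>m\<ge>1. \<exists>q\<ge>1. \<forall>\<phi>\<in>\<A> q.
     (\<lambda>\<epsilon>. cmod (r (dilate \<epsilon> \<phi>))) \<in> O[at_right 0](\<lambda>\<epsilon>. \<epsilon> ^ m)}"

definition C_mod_ring :: "((real ^ 'n \<Rightarrow> complex) \<Rightarrow> complex) ring" where
  "C_mod_ring = \<lparr>carrier = C_mod,
     mult = (\<lambda>r s. \<lambda>\<phi>\<in>\<A> 0. r \<phi> * s \<phi>), one = (\<lambda>\<phi>\<in>\<A> 0. 1),
     zero = (\<lambda>\<phi>\<in>\<A> 0. 0), add = (\<lambda>r s. \<lambda>\<phi>\<in>\<A> 0. r \<phi> + s \<phi>)\<rparr>"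

text \<open>
  The elements of the quotient are the cosets of \<open>C_null\<close>; a representative of a class is
  thus an element of it.
\<close>

definition C_gen :: "((real ^ 'n \<Rightarrow> complex) \<Rightarrow> complex) set ring" where
  "C_gen = C_mod_ring Quot C_null"

definition zero_divisor :: "('a, 'b) ring_scheme \<Rightarrow> 'a \<Rightarrow> bool" where
  "zero_divisor R a \<longleftrightarrow>
     a \<in> carrier R \<and> (\<exists>b\<in>carrier R. b \<noteq> \<zero>\<^bsub>R\<^esub> \<and> a \<otimes>\<^bsub>R\<^esub> b = \<zero>\<^bsub>R\<^esub>)"


text \<open>
  Checks: on nowhere vanishing gauges the library's \<open>O\<close> agrees with the version with a strict
  inequality; dilations preserve \<open>\<A> q\<close>; the quotient is formed from a commutative ring
  and an ideal of it.
\<close>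

lemma bigo_at_right_0_iff:
  fixes f g :: "real \<Rightarrow> real"
  assumes "\<And>\<epsilon>. \<epsilon> > 0 \<Longrightarrow> g \<epsilon> \<noteq> 0"
  shows "f \<in> O[at_right 0](g) \<longleftrightarrow>
    (\<exists>C>0. \<exists>\<epsilon>0>0. \<forall>\<epsilon>. 0 < \<epsilon> \<and> \<epsilon> < \<epsilon>0 \<longrightarrow> \<bar>f \<epsilon>\<bar> < C * \<bar>g \<epsilon>\<bar>)"
proof
  assume "f \<in> O[at_right 0](g)"
  then obtain c where c: "c > 0" "\<forall>\<^sub>F x in at_right 0. norm (f x) \<le> c * norm (g x)"
    by (elim landau_o.bigE)
  then obtain b where b: "b > 0" "\<And>x. 0 < x \<Longrightarrow> x < b \<Longrightarrow> \<bar>f x\<bar> \<le> c * \<bar>g x\<bar>"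
    by (auto simp: eventually_at_right_field)
  have "\<bar>f x\<bar> < (c + 1) * \<bar>g x\<bar>" if "0 < x" "x < b" for x
    using b(2)[OF that] assms[OF that(1)] by (simp add: algebra_simps add_strict_increasing2)
  with c(1) b(1) show "\<exists>C>0. \<exists>\<epsilon>0>0. \<forall>\<epsilon>. 0 < \<epsilon> \<and> \<epsilon> < \<epsilon>0 \<longrightarrow> \<bar>f \<epsilon>\<bar> < C * \<bar>g \<epsilon>\<bar>"
    by (intro exI[of _ "c + 1"] conjI exI[of _ b]) auto
next
  assume "\<exists>C>0. \<exists>\<epsilon>0>0. \<forall>\<epsilon>. 0 < \<epsilon> \<and> \<epsilon> < \<epsilon>0 \<longrightarrow> \<bar>f \<epsilon>\<bar> < C * \<bar>g \<epsilon>\<bar>"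
  then obtain C b where "C > 0" "b > 0" "\<And>x. 0 < x \<Longrightarrow> x < b \<Longrightarrow> \<bar>f x\<bar> < C * \<bar>g x\<bar>"
    by blast
  then show "f \<in> O[at_right 0](g)"
    by (intro bigoI[of _ C]) (auto simp: eventually_at_right_field intro!: exI[of _ b] less_imp_le)
qed

lemma C_k_dilate:
  assumes "C_k k f"
  shows "C_k k (\<lambda>x. c * f (a *\<^sub>R x))"
  using assms
proof (induction k arbitrary: f c)
  case 0
  then have "continuous_on UNIV f"
    by simp
  then have "continuous_on UNIV (\<lambda>x. f (a *\<^sub>R x))"
    using continuous_on_compose2[of UNIV f UNIV "\<lambda>x. a *\<^sub>R x"]
    by (simp add: continuous_on_scaleR)
  then show ?case
    by (simp add: continuous_on_mult_left)
next
  case (Suc k)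
  define D where "D = (\<lambda>x. frechet_derivative f (at x))"
  have D: "(f has_derivative D x) (at x)" for x
    using Suc.prems unfolding C_k.simps D_def frechet_derivative_works by blast
  have CD: "C_k k (\<lambda>x. D x (axis i 1))" for i
    using Suc.prems unfolding C_k.simps D_def by blast
  have der: "((\<lambda>x. c * f (a *\<^sub>R x)) has_derivative (\<lambda>h. c * D (a *\<^sub>R x) (a *\<^sub>R h))) (at x)" for x
    using has_derivative_mult_right[OF has_derivative_compose[of "\<lambda>x. a *\<^sub>R x" "\<lambda>x. a *\<^sub>R x" x UNIV f "D (a *\<^sub>R x)"], of c]
      D[of "a *\<^sub>R x"] has_derivative_scaleR_right[OF has_derivative_ident]
    by blast
  have lin: "linear (D x)" for x
    using D[of x] by (rule has_derivative_linear)
  have fd: "frechet_derivative (\<lambda>x. c * f (a *\<^sub>R x)) (at x) (axis i 1) =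
      (c * of_real a) * D (a *\<^sub>R x) (axis i 1)" for x i
  proof -
    have "frechet_derivative (\<lambda>x. c * f (a *\<^sub>R x)) (at x) = (\<lambda>h. c * D (a *\<^sub>R x) (a *\<^sub>R h))"
      using frechet_derivative_at[OF der] by metis
    then show ?thesis
      using linear_cmul[OF lin, of "a *\<^sub>R x" a "axis i 1"]
      by (simp add: scaleR_conv_of_real)
  qed
  have "C_k k (\<lambda>x. (c * of_real a) * D (a *\<^sub>R x) (axis i 1))" for i
    using Suc.IH[OF CD] .
  moreover have "(\<lambda>x. c * f (a *\<^sub>R x)) differentiable (at x)" for x
    using der differentiable_def by blast
  ultimately show ?case
    by (simp only: C_k.simps fd) blast
qed

lemma integral_dilate:
  fixes f :: "real ^ 'n \<Rightarrow> complex"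
  assumes [measurable]: "f \<in> borel_measurable borel" and "\<epsilon> > 0"
  shows "(LINT x|lborel. of_real (\<epsilon> powi (- int CARD('n))) * f ((1 / \<epsilon>) *\<^sub>R x)) = (LINT x|lborel. f x)"
    (is "(LINT x|lborel. ?g x) = _")
proof -
  have "(lborel :: (real ^ 'n) measure) =
      density (distr lborel borel (\<lambda>x. 0 + \<epsilon> *\<^sub>R x)) (\<lambda>_. \<bar>\<epsilon>\<bar> ^ DIM(real ^ 'n))"
    using \<open>\<epsilon> > 0\<close> by (intro lborel_affine) simp
  then have "(LINT x|lborel. ?g x) =
      (LINT x|density (distr lborel borel (\<lambda>x. \<epsilon> *\<^sub>R x)) (\<lambda>_. ennreal (\<epsilon> ^ CARD('n))). ?g x)"
    using \<open>\<epsilon> > 0\<close> by simp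
  also have "\<dots> = (LINT x|distr lborel borel (\<lambda>x :: real ^ 'n. \<epsilon> *\<^sub>R x). \<epsilon> ^ CARD('n) *\<^sub>R ?g x)"
    using \<open>\<epsilon> > 0\<close> by (subst integral_density) auto
  also have "\<dots> = (LINT x|lborel. \<epsilon> ^ CARD('n) *\<^sub>R ?g (\<epsilon> *\<^sub>R x))"
    by (subst integral_distr) auto
  also have "\<dots> = (LINT x|lborel. f x)"
    using \<open>\<epsilon> > 0\<close>
    by (intro Bochner_Integration.integral_cong)
      (auto simp: scaleR_conv_of_real[where 'a = complex] power_int_minus field_simps simp flip: of_real_mult)
  finally show ?thesis .
qed

lemma monomial_scaleR: "monomial \<alpha> (c *\<^sub>R x) = c ^ (\<Sum>i\<in>UNIV. \<alpha> i) * monomial \<alpha> x"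
  by (simp add: monomial_def power_mult_distrib prod.distrib power_sum)

lemma dilate_in_A:
  fixes \<phi> :: "real ^ 'n \<Rightarrow> complex"
  assumes "\<phi> \<in> \<A> q" "\<epsilon> > 0"
  shows "dilate \<epsilon> \<phi> \<in> \<A> q"
proof -
  have sm: "smooth \<phi>" and cpt: "compact (closure {x. \<phi> x \<noteq> 0})"
    using assms(1) by (auto simp: \<A>_def test_fun_def)
  have "continuous_on UNIV \<phi>"
    using sm C_k.simps(1) unfolding smooth_def by blast
  then have meas [measurable]: "\<phi> \<in> borel_measurable borel"
    by (rule borel_measurable_continuous_onI)
  have mon [measurable]: "monomial \<alpha> \<in> borel_measurable borel" for \<alpha> :: "'n \<Rightarrow> nat"
    unfolding monomial_def by (intro borel_measurable_continuous_onI continuous_intros)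
  have "smooth (dilate \<epsilon> \<phi>)"
    using sm C_k_dilate unfolding smooth_def dilate_def by blast
  moreover have "{x. dilate \<epsilon> \<phi> x \<noteq> 0} = (*\<^sub>R) \<epsilon> ` {x. \<phi> x \<noteq> 0}"
  proof (intro equalityI subsetI)
    fix x assume "x \<in> {x. dilate \<epsilon> \<phi> x \<noteq> 0}"
    then show "x \<in> (*\<^sub>R) \<epsilon> ` {x. \<phi> x \<noteq> 0}"
      using assms(2) by (intro image_eqI[of _ _ "(1 / \<epsilon>) *\<^sub>R x"]) (auto simp: dilate_def)
  qed (use assms(2) in \<open>auto simp: dilate_def\<close>)
  then have "compact (closure {x. dilate \<epsilon> \<phi> x \<noteq> 0})"
    using compact_scaling[OF cpt, of \<epsilon>] by (simp add: closure_scaleR)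
  moreover have "(LINT x|lborel. dilate \<epsilon> \<phi> x) = 1"
    using assms integral_dilate[OF meas] by (simp add: dilate_def \<A>_def)
  moreover have "(LINT x|lborel. of_real (monomial \<alpha> x) * dilate \<epsilon> \<phi> x) = 0"
    if "1 \<le> (\<Sum>i\<in>UNIV. \<alpha> i)" "(\<Sum>i\<in>UNIV. \<alpha> i) \<le> q" for \<alpha>
  proof -
    let ?h = "\<lambda>x. of_real (\<epsilon> ^ (\<Sum>i\<in>UNIV. \<alpha> i)) * (of_real (monomial \<alpha> x) * \<phi> x)"
    have "(LINT x|lborel. of_real (monomial \<alpha> x) * dilate \<epsilon> \<phi> x) =
        (LINT x|lborel. of_real (\<epsilon> powi (- int CARD('n))) * ?h ((1 / \<epsilon>) *\<^sub>R x))"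
      using assms(2)
      by (intro Bochner_Integration.integral_cong)
        (auto simp: dilate_def monomial_scaleR power_divide)
    also have "\<dots> = (LINT x|lborel. ?h x)"
      using assms(2) by (intro integral_dilate) measurable
    also have "\<dots> = 0"
      using assms(1) that by (simp add: \<A>_def)
    finally show ?thesis .
  qed
  ultimately show ?thesis
    by (auto simp: \<A>_def test_fun_def)
qed

lemma A_mono: "p \<le> q \<Longrightarrow> \<A> q \<subseteq> \<A> p"
  by (auto simp: \<A>_def)

lemma powi_bigo:
  fixes a b :: int
  assumes "a \<le> b"
  shows "(\<lambda>\<epsilon>::real. \<epsilon> powi b) \<in> O[at_right 0](\<lambda>\<epsilon>. \<epsilon> powi a)"
proof (rule bigoI[of _ 1])
  have "\<epsilon> powi b \<le> \<epsilon> powi a" if "0 < \<epsilon>" "\<epsilon> < 1" for \<epsilon> :: real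
    using that assms by (intro power_int_decreasing) auto
  then show "\<forall>\<^sub>F \<epsilon>::real in at_right 0. norm (\<epsilon> powi b) \<le> 1 * norm (\<epsilon> powi a)"
    by (auto simp: eventually_at_right_field intro!: exI[of _ 1])
qed

lemma bigo_powi_add:
  assumes "(\<lambda>\<epsilon>. cmod (f \<epsilon>)) \<in> O[at_right 0](\<lambda>\<epsilon>. \<epsilon> powi a)"
    and "(\<lambda>\<epsilon>. cmod (g \<epsilon>)) \<in> O[at_right 0](\<lambda>\<epsilon>. \<epsilon> powi b)" and "c \<le> a" "c \<le> b"
  shows "(\<lambda>\<epsilon>. cmod (f \<epsilon> + g \<epsilon>)) \<in> O[at_right 0](\<lambda>\<epsilon>. \<epsilon> powi c)"
proof -
  have "(\<lambda>\<epsilon>. cmod (f \<epsilon>) + cmod (g \<epsilon>)) \<in> O[at_right 0](\<lambda>\<epsilon>. \<epsilon> powi c)"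
    by (intro sum_in_bigo landau_o.big_trans[OF assms(1) powi_bigo[OF assms(3)]]
        landau_o.big_trans[OF assms(2) powi_bigo[OF assms(4)]])
  moreover have "(\<lambda>\<epsilon>. cmod (f \<epsilon> + g \<epsilon>)) \<in> O[at_right 0](\<lambda>\<epsilon>. cmod (f \<epsilon>) + cmod (g \<epsilon>))"
    by (intro landau_o.big_mono always_eventually allI) (simp add: norm_triangle_ineq)
  ultimately show ?thesis
    by (rule landau_o.big_trans[rotated])
qed

lemma bigo_powi_mult:
  assumes "(\<lambda>\<epsilon>. cmod (f \<epsilon>)) \<in> O[at_right 0](\<lambda>\<epsilon>. \<epsilon> powi a)"
    and "(\<lambda>\<epsilon>. cmod (g \<epsilon>)) \<in> O[at_right 0](\<lambda>\<epsilon>. \<epsilon> powi b)" and "c \<le> a + b"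
  shows "(\<lambda>\<epsilon>. cmod (f \<epsilon> * g \<epsilon>)) \<in> O[at_right 0](\<lambda>\<epsilon>. \<epsilon> powi c)"
proof -
  have "(\<lambda>\<epsilon>. cmod (f \<epsilon>) * cmod (g \<epsilon>)) \<in> O[at_right 0](\<lambda>\<epsilon>. \<epsilon> powi a * \<epsilon> powi b)"
    using assms by (intro landau_o.big.mult)
  also have "(\<lambda>\<epsilon>::real. \<epsilon> powi a * \<epsilon> powi b) \<in> O[at_right 0](\<lambda>\<epsilon>. \<epsilon> powi (a + b))"
    by (rule landau_o.big_mono)
      (auto simp: eventually_at_right_field power_int_add intro!: exI[of _ 1])
  also have "(\<lambda>\<epsilon>::real. \<epsilon> powi (a + b)) \<in> O[at_right 0](\<lambda>\<epsilon>. \<epsilon> powi c)"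
    using assms(3) by (rule powi_bigo)
  finally show ?thesis
    by (simp only: norm_mult)
qed

lemma bigo_restrict_A0:
  assumes "\<phi> \<in> \<A> q"
  shows "(\<lambda>\<epsilon>. cmod (restrict r (\<A> 0) (dilate \<epsilon> \<phi>))) \<in> O[at_right 0](g) \<longleftrightarrow>
    (\<lambda>\<epsilon>. cmod (r (dilate \<epsilon> \<phi>))) \<in> O[at_right 0](g)"
proof (rule landau_o.big.in_cong)
  have "dilate \<epsilon> \<phi> \<in> \<A> 0" if "\<epsilon> > 0" for \<epsilon>
    using dilate_in_A[OF assms that] A_mono by blast
  then show "\<forall>\<^sub>F \<epsilon> in at_right 0. cmod (restrict r (\<A> 0) (dilate \<epsilon> \<phi>)) = cmod (r (dilate \<epsilon> \<phi>))"
    by (auto simp: eventually_at_right_field intro!: exI[of _ 1])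
qed

lemma all_ge_1_iff: "(\<And>m. P (Suc m) \<Longrightarrow> P m) \<Longrightarrow> (\<forall>m\<ge>1. P m) \<longleftrightarrow> (\<forall>m. P m)"
  by auto

lemma ex_ge_1_iff: "(\<And>m. P m \<Longrightarrow> P (Suc m)) \<Longrightarrow> (\<exists>m\<ge>1. P m) \<longleftrightarrow> (\<exists>m. P m)"
  using Suc_le_mono le0 One_nat_def by metis

lemma C_null_iff:
  fixes r :: "(real ^ 'n \<Rightarrow> complex) \<Rightarrow> complex"
  shows "r \<in> C_null \<longleftrightarrow> r \<in> \<A> 0 \<rightarrow>\<^sub>E UNIV \<and> (\<forall>m. \<exists>q\<ge>1. \<forall>\<phi>\<in>\<A> q.
     (\<lambda>\<epsilon>. cmod (r (dilate \<epsilon> \<phi>))) \<in> O[at_right 0](\<lambda>\<epsilon>. \<epsilon> powi int m))" (is "_ \<longleftrightarrow> _ \<and> (\<forall>m. ?P m)")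
proof -
  have "?P m" if "?P (Suc m)" for m
  proof -
    have "(\<lambda>\<epsilon>. cmod (r (dilate \<epsilon> \<phi>))) \<in> O[at_right 0](\<lambda>\<epsilon>. \<epsilon> powi int m)"
      if "(\<lambda>\<epsilon>. cmod (r (dilate \<epsilon> \<phi>))) \<in> O[at_right 0](\<lambda>\<epsilon>. \<epsilon> powi int (Suc m))" for \<phi>
      using that by (rule landau_o.big_trans) (rule powi_bigo, simp)
    then show ?thesis
      using that by (elim exE conjE) (intro exI conjI ballI, assumption, blast)
  qed
  then have "(\<forall>m\<ge>1. ?P m) \<longleftrightarrow> (\<forall>m. ?P m)"
    by (rule all_ge_1_iff)
  then show ?thesis
    by (simp add: C_null_def power_int_of_nat)
qed

lemma C_mod_iff:
  fixes r :: "(real ^ 'n \<Rightarrow> complex) \<Rightarrow> complex"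
  shows "r \<in> C_mod \<longleftrightarrow> r \<in> \<A> 0 \<rightarrow>\<^sub>E UNIV \<and> (\<exists>N. \<forall>\<phi>\<in>\<A> N.
     (\<lambda>\<epsilon>. cmod (r (dilate \<epsilon> \<phi>))) \<in> O[at_right 0](\<lambda>\<epsilon>. \<epsilon> powi (- int N)))" (is "_ \<longleftrightarrow> _ \<and> (\<exists>N. ?P N)")
proof -
  have "?P (Suc N)" if "?P N" for N
  proof
    fix \<phi> :: "real ^ 'n \<Rightarrow> complex"
    assume "\<phi> \<in> \<A> (Suc N)"
    then have "\<phi> \<in> \<A> N"
      using A_mono[of N "Suc N"] by auto
    with that have "(\<lambda>\<epsilon>. cmod (r (dilate \<epsilon> \<phi>))) \<in> O[at_right 0](\<lambda>\<epsilon>. \<epsilon> powi (- int N))"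
      by blast
    then show "(\<lambda>\<epsilon>. cmod (r (dilate \<epsilon> \<phi>))) \<in> O[at_right 0](\<lambda>\<epsilon>. \<epsilon> powi (- int (Suc N)))"
      by (rule landau_o.big_trans) (rule powi_bigo, simp)
  qed
  then have "(\<exists>N\<ge>1. ?P N) \<longleftrightarrow> (\<exists>N. ?P N)"
    by (rule ex_ge_1_iff)
  then show ?thesis
    by (simp add: C_mod_def)
qed

lemma C_mod_add:
  assumes "r \<in> C_mod" "s \<in> C_mod"
  shows "(\<lambda>\<phi>\<in>\<A> 0. r \<phi> + s \<phi>) \<in> C_mod"
proof -
  from assms obtain M N where
    M: "\<And>\<phi>. \<phi> \<in> \<A> M \<Longrightarrow> (\<lambda>\<epsilon>. cmod (r (dilate \<epsilon> \<phi>))) \<in> O[at_right 0](\<lambda>\<epsilon>. \<epsilon> powi (- int M))" and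
    N: "\<And>\<phi>. \<phi> \<in> \<A> N \<Longrightarrow> (\<lambda>\<epsilon>. cmod (s (dilate \<epsilon> \<phi>))) \<in> O[at_right 0](\<lambda>\<epsilon>. \<epsilon> powi (- int N))"
    unfolding C_mod_iff by blast
  have "(\<lambda>\<epsilon>. cmod (r (dilate \<epsilon> \<phi>) + s (dilate \<epsilon> \<phi>))) \<in> O[at_right 0](\<lambda>\<epsilon>. \<epsilon> powi (- int (M + N)))"
    if "\<phi> \<in> \<A> (M + N)" for \<phi>
  proof (rule bigo_powi_add)
    show "(\<lambda>\<epsilon>. cmod (r (dilate \<epsilon> \<phi>))) \<in> O[at_right 0](\<lambda>\<epsilon>. \<epsilon> powi (- int M))"
      using that A_mono[of M "M + N"] by (intro M) auto
    show "(\<lambda>\<epsilon>. cmod (s (dilate \<epsilon> \<phi>))) \<in> O[at_right 0](\<lambda>\<epsilon>. \<epsilon> powi (- int N))"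
      using that A_mono[of N "M + N"] by (intro N) auto
  qed auto
  then show ?thesis
    unfolding C_mod_iff by (auto simp: bigo_restrict_A0 simp del: restrict_apply intro!: exI[of _ "M + N"])
qed

lemma C_mod_mult:
  assumes "r \<in> C_mod" "s \<in> C_mod"
  shows "(\<lambda>\<phi>\<in>\<A> 0. r \<phi> * s \<phi>) \<in> C_mod"
proof -
  from assms obtain M N where
    M: "\<And>\<phi>. \<phi> \<in> \<A> M \<Longrightarrow> (\<lambda>\<epsilon>. cmod (r (dilate \<epsilon> \<phi>))) \<in> O[at_right 0](\<lambda>\<epsilon>. \<epsilon> powi (- int M))" and
    N: "\<And>\<phi>. \<phi> \<in> \<A> N \<Longrightarrow> (\<lambda>\<epsilon>. cmod (s (dilate \<epsilon> \<phi>))) \<in> O[at_right 0](\<lambda>\<epsilon>. \<epsilon> powi (- int N))"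
    unfolding C_mod_iff by blast
  have "(\<lambda>\<epsilon>. cmod (r (dilate \<epsilon> \<phi>) * s (dilate \<epsilon> \<phi>))) \<in> O[at_right 0](\<lambda>\<epsilon>. \<epsilon> powi (- int (M + N)))"
    if "\<phi> \<in> \<A> (M + N)" for \<phi>
  proof (rule bigo_powi_mult)
    show "(\<lambda>\<epsilon>. cmod (r (dilate \<epsilon> \<phi>))) \<in> O[at_right 0](\<lambda>\<epsilon>. \<epsilon> powi (- int M))"
      using that A_mono[of M "M + N"] by (intro M) auto
    show "(\<lambda>\<epsilon>. cmod (s (dilate \<epsilon> \<phi>))) \<in> O[at_right 0](\<lambda>\<epsilon>. \<epsilon> powi (- int N))"
      using that A_mono[of N "M + N"] by (intro N) auto
  qed auto
  then show ?thesis
    unfolding C_mod_iff by (auto simp: bigo_restrict_A0 simp del: restrict_apply intro!: exI[of _ "M + N"])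
qed

lemma C_mod_const: "(\<lambda>\<phi>\<in>\<A> 0. c) \<in> (C_mod :: ((real ^ 'n \<Rightarrow> complex) \<Rightarrow> complex) set)"
proof -
  have "(\<lambda>\<epsilon>. cmod (restrict (\<lambda>_. c) (\<A> 0) (dilate \<epsilon> \<phi>))) \<in> O[at_right 0](\<lambda>\<epsilon>. \<epsilon> powi (- int 0))"
    if "\<phi> \<in> \<A> 0" for \<phi> :: "real ^ 'n \<Rightarrow> complex"
    unfolding bigo_restrict_A0[OF that] by simp
  then show ?thesis
    unfolding C_mod_iff by (auto simp del: restrict_apply intro!: exI[of _ 0])
qed

lemma C_null_add:
  assumes "r \<in> C_null" "s \<in> C_null"
  shows "(\<lambda>\<phi>\<in>\<A> 0. r \<phi> + s \<phi>) \<in> C_null"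
  unfolding C_null_iff
proof (intro conjI allI)
  fix m
  from assms obtain M N where
    M: "\<And>\<phi>. \<phi> \<in> \<A> M \<Longrightarrow> (\<lambda>\<epsilon>. cmod (r (dilate \<epsilon> \<phi>))) \<in> O[at_right 0](\<lambda>\<epsilon>. \<epsilon> powi int m)" "M \<ge> 1" and
    N: "\<And>\<phi>. \<phi> \<in> \<A> N \<Longrightarrow> (\<lambda>\<epsilon>. cmod (s (dilate \<epsilon> \<phi>))) \<in> O[at_right 0](\<lambda>\<epsilon>. \<epsilon> powi int m)"
    unfolding C_null_iff by meson
  have "(\<lambda>\<epsilon>. cmod (r (dilate \<epsilon> \<phi>) + s (dilate \<epsilon> \<phi>))) \<in> O[at_right 0](\<lambda>\<epsilon>. \<epsilon> powi int m)"
    if "\<phi> \<in> \<A> (M + N)" for \<phi>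
  proof (rule bigo_powi_add)
    show "(\<lambda>\<epsilon>. cmod (r (dilate \<epsilon> \<phi>))) \<in> O[at_right 0](\<lambda>\<epsilon>. \<epsilon> powi int m)"
      using that A_mono[of M "M + N"] by (intro M) auto
    show "(\<lambda>\<epsilon>. cmod (s (dilate \<epsilon> \<phi>))) \<in> O[at_right 0](\<lambda>\<epsilon>. \<epsilon> powi int m)"
      using that A_mono[of N "M + N"] by (intro N) auto
  qed auto
  then show "\<exists>q\<ge>1. \<forall>\<phi>\<in>\<A> q.
      (\<lambda>\<epsilon>. cmod (restrict (\<lambda>\<phi>. r \<phi> + s \<phi>) (\<A> 0) (dilate \<epsilon> \<phi>))) \<in> O[at_right 0](\<lambda>\<epsilon>. \<epsilon> powi int m)"
    using M(2) by (auto simp: bigo_restrict_A0 simp del: restrict_apply intro!: exI[of _ "M + N"])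
qed auto

lemma C_null_mult:
  assumes "r \<in> C_mod" "s \<in> C_null"
  shows "(\<lambda>\<phi>\<in>\<A> 0. r \<phi> * s \<phi>) \<in> C_null"
  unfolding C_null_iff
proof (intro conjI allI)
  fix m
  from assms(1) obtain M where
    M: "\<And>\<phi>. \<phi> \<in> \<A> M \<Longrightarrow> (\<lambda>\<epsilon>. cmod (r (dilate \<epsilon> \<phi>))) \<in> O[at_right 0](\<lambda>\<epsilon>. \<epsilon> powi (- int M))"
    unfolding C_mod_iff by blast
  from assms(2) obtain N where
    N: "\<And>\<phi>. \<phi> \<in> \<A> N \<Longrightarrow> (\<lambda>\<epsilon>. cmod (s (dilate \<epsilon> \<phi>))) \<in> O[at_right 0](\<lambda>\<epsilon>. \<epsilon> powi int (m + M))"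
      "N \<ge> 1"
    unfolding C_null_iff by meson
  have "(\<lambda>\<epsilon>. cmod (r (dilate \<epsilon> \<phi>) * s (dilate \<epsilon> \<phi>))) \<in> O[at_right 0](\<lambda>\<epsilon>. \<epsilon> powi int m)"
    if "\<phi> \<in> \<A> (M + N)" for \<phi>
  proof (rule bigo_powi_mult)
    show "(\<lambda>\<epsilon>. cmod (r (dilate \<epsilon> \<phi>))) \<in> O[at_right 0](\<lambda>\<epsilon>. \<epsilon> powi (- int M))"
      using that A_mono[of M "M + N"] by (intro M) auto
    show "(\<lambda>\<epsilon>. cmod (s (dilate \<epsilon> \<phi>))) \<in> O[at_right 0](\<lambda>\<epsilon>. \<epsilon> powi int (m + M))"
      using that A_mono[of N "M + N"] by (intro N) auto
  qed auto
  then show "\<exists>q\<ge>1. \<forall>\<phi>\<in>\<A> q.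
      (\<lambda>\<epsilon>. cmod (restrict (\<lambda>\<phi>. r \<phi> * s \<phi>) (\<A> 0) (dilate \<epsilon> \<phi>))) \<in> O[at_right 0](\<lambda>\<epsilon>. \<epsilon> powi int m)"
    using N(2) by (auto simp: bigo_restrict_A0 simp del: restrict_apply intro!: exI[of _ "M + N"])
qed auto

lemma C_null_subset: "C_null \<subseteq> (C_mod :: ((real ^ 'n \<Rightarrow> complex) \<Rightarrow> complex) set)"
proof
  fix r :: "(real ^ 'n \<Rightarrow> complex) \<Rightarrow> complex"
  assume r: "r \<in> C_null"
  then obtain q where q: "\<And>\<phi>. \<phi> \<in> \<A> q \<Longrightarrow>
      (\<lambda>\<epsilon>. cmod (r (dilate \<epsilon> \<phi>))) \<in> O[at_right 0](\<lambda>\<epsilon>. \<epsilon> powi int 0)"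
    unfolding C_null_iff by meson
  have "(\<lambda>\<epsilon>. cmod (r (dilate \<epsilon> \<phi>))) \<in> O[at_right 0](\<lambda>\<epsilon>. \<epsilon> powi (- int q))" if "\<phi> \<in> \<A> q" for \<phi>
    using landau_o.big_trans[OF q[OF that] powi_bigo] by simp
  then show "r \<in> C_mod"
    using r unfolding C_null_iff C_mod_iff by blast
qed

lemma C_null_zero: "(\<lambda>\<phi>\<in>\<A> 0. 0) \<in> (C_null :: ((real ^ 'n \<Rightarrow> complex) \<Rightarrow> complex) set)"
  unfolding C_null_iff
proof (intro conjI allI)
  fix m
  have "(\<lambda>\<epsilon>. cmod (restrict (\<lambda>_. 0) (\<A> 0) (dilate \<epsilon> \<phi>))) \<in> O[at_right 0](\<lambda>\<epsilon>. \<epsilon> powi int m)"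
    if "\<phi> \<in> \<A> 1" for \<phi> :: "real ^ 'n \<Rightarrow> complex"
    unfolding bigo_restrict_A0[OF that] by simp
  then show "\<exists>q\<ge>1. \<forall>\<phi>\<in>\<A> q.
      (\<lambda>\<epsilon>. cmod (restrict (\<lambda>_. 0) (\<A> 0) (dilate \<epsilon> (\<phi> :: real ^ 'n \<Rightarrow> complex)))) \<in> O[at_right 0](\<lambda>\<epsilon>. \<epsilon> powi int m)"
    by (intro exI[of _ 1]) auto
qed auto

lemma C_mod_extensional: "r \<in> C_mod \<Longrightarrow> (\<lambda>\<phi>\<in>\<A> 0. r \<phi>) = r"
  unfolding C_mod_def by (auto intro: extensional_restrict)

lemma C_mod_neutral:
  assumes "r \<in> C_mod"
  shows "(\<lambda>\<phi>\<in>\<A> 0. r \<phi> + (if \<phi> \<in> \<A> 0 then 0 else undefined)) = r"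
    and "(\<lambda>\<phi>\<in>\<A> 0. r \<phi> * (if \<phi> \<in> \<A> 0 then 1 else undefined)) = r"
proof -
  have "(\<lambda>\<phi>\<in>\<A> 0. r \<phi> + (if \<phi> \<in> \<A> 0 then 0 else undefined)) = (\<lambda>\<phi>\<in>\<A> 0. r \<phi>)"
    "(\<lambda>\<phi>\<in>\<A> 0. r \<phi> * (if \<phi> \<in> \<A> 0 then 1 else undefined)) = (\<lambda>\<phi>\<in>\<A> 0. r \<phi>)"
    by (auto intro!: restrict_ext)
  then show "(\<lambda>\<phi>\<in>\<A> 0. r \<phi> + (if \<phi> \<in> \<A> 0 then 0 else undefined)) = r"
    "(\<lambda>\<phi>\<in>\<A> 0. r \<phi> * (if \<phi> \<in> \<A> 0 then 1 else undefined)) = r"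
    by (simp_all only: C_mod_extensional[OF assms])
qed

lemma cring_C_mod_ring: "cring (C_mod_ring :: ((real ^ 'n \<Rightarrow> complex) \<Rightarrow> complex) ring)"
  (is "cring ?R")
proof (rule cringI)
  show "abelian_group ?R"
  proof (rule abelian_groupI)
    fix r :: "(real ^ 'n \<Rightarrow> complex) \<Rightarrow> complex"
    assume "r \<in> carrier C_mod_ring"
    then have "(\<lambda>\<phi>\<in>\<A> 0. (\<lambda>\<phi>\<in>\<A> 0. - 1) \<phi> * r \<phi>) \<in> C_mod"
      by (intro C_mod_mult C_mod_const) (simp add: C_mod_ring_def)
    then show "\<exists>s\<in>carrier C_mod_ring. s \<oplus>\<^bsub>C_mod_ring\<^esub> r = \<zero>\<^bsub>C_mod_ring\<^esub>"
      by (intro bexI) (auto simp: C_mod_ring_def)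
  qed (auto simp: C_mod_ring_def C_mod_add C_mod_const C_mod_neutral algebra_simps)
  show "comm_monoid ?R"
    by (rule comm_monoidI)
      (auto simp: C_mod_ring_def C_mod_mult C_mod_const C_mod_neutral algebra_simps)
qed (auto simp: C_mod_ring_def algebra_simps)

lemma ideal_C_null: "ideal C_null (C_mod_ring :: ((real ^ 'n \<Rightarrow> complex) \<Rightarrow> complex) ring)"
  (is "ideal ?I ?R")
proof -
  interpret cring ?R
    by (rule cring_C_mod_ring)
  have mult: "r \<otimes>\<^bsub>C_mod_ring\<^esub> s \<in> C_null"
    if "s \<in> C_null" "r \<in> carrier C_mod_ring" for r s :: "(real ^ 'n \<Rightarrow> complex) \<Rightarrow> complex"
    using that C_null_mult by (simp add: C_mod_ring_def)
  have sub: "?I \<subseteq> carrier ?R"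
    using C_null_subset by (simp add: C_mod_ring_def)
  show ?thesis
  proof (rule idealI[OF ring_axioms])
    show "subgroup ?I (add_monoid ?R)"
    proof (rule subgroup.intro)
      fix r :: "(real ^ 'n \<Rightarrow> complex) \<Rightarrow> complex"
      assume r: "r \<in> C_null"
      then have "\<ominus>\<^bsub>C_mod_ring\<^esub> r = (\<ominus>\<^bsub>C_mod_ring\<^esub> \<one>\<^bsub>C_mod_ring\<^esub>) \<otimes>\<^bsub>C_mod_ring\<^esub> r"
        using subsetD[OF sub r] by (simp add: l_minus)
      then show "inv\<^bsub>add_monoid C_mod_ring\<^esub> r \<in> C_null"
        using mult[OF r a_inv_closed[OF one_closed]] unfolding a_inv_def by simp
    next
      fix r s :: "(real ^ 'n \<Rightarrow> complex) \<Rightarrow> complex"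
      assume "r \<in> C_null" "s \<in> C_null"
      then show "r \<otimes>\<^bsub>add_monoid C_mod_ring\<^esub> s \<in> C_null"
        using C_null_add by (simp add: C_mod_ring_def)
    next
      show "\<one>\<^bsub>add_monoid ?R\<^esub> \<in> ?I"
        using C_null_zero by (simp add: C_mod_ring_def)
    qed (use sub in simp)
  next
    fix r s :: "(real ^ 'n \<Rightarrow> complex) \<Rightarrow> complex"
    assume r: "r \<in> C_null" and s: "s \<in> carrier C_mod_ring"
    show "s \<otimes>\<^bsub>C_mod_ring\<^esub> r \<in> C_null"
      using mult[OF r s] .
    moreover have "r \<otimes>\<^bsub>C_mod_ring\<^esub> s = s \<otimes>\<^bsub>C_mod_ring\<^esub> r"
      using r s sub by (intro m_comm) auto
    ultimately show "r \<otimes>\<^bsub>C_mod_ring\<^esub> s \<in> C_null"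
      by simp
  qed
qed

end

theory Submission
  imports Defs
begin

text \<open>
  A class is invertible as soon as some representative \<open>r\<close> satisfies, for some \<open>N\<close> and along the
  dilations of every \<open>\<phi> \<in> \<A> N\<close>, a lower bound \<open>C * \<epsilon> ^ N \<le> \<bar>r(S\<^sub>\<epsilon> \<phi>)\<bar>\<close>: the pointwise inverse
  is then moderate (\<open>gen_class_UnitsI\<close>). So if the class is not invertible, for every \<open>q\<close> there is
  some \<open>\<phi> \<in> \<A> q\<close> along whose dilations \<open>r\<close> is infinitely often smaller than any prescribed
  multiple of a power of \<open>\<epsilon>\<close> growing with \<open>q\<close>.

  A representative with zeros (\<open>non_unit_representative\<close>) results from replacing these small values
  of \<open>r\<close> by \<open>0\<close>. The change has to be a null function, which means that on \<open>\<A> q\<close> with \<open>q\<close> large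
  only values below a high power of \<open>\<epsilon>\<close> may be altered. The decision is therefore made
  from a test function \<open>\<psi>\<close> alone, by two quantities that are compatible with dilation. One is a
  positive number \<open>width \<psi>\<close>, homogeneous in \<open>\<epsilon>\<close>, which plays the part of the scale. The other
  is the position of \<open>\<psi>\<close> in the decreasing chain of the sets \<open>\<A> q\<close>, which plays the part of the exponent. The
  exponent is available because no test function lies in all \<open>\<A> q\<close> (\<open>finite_moment_order\<close>); for a
  function in all of them no single power would be small enough.

  If \<open>r\<close> has such zeros, the indicator function of its zero set annihilates \<open>r\<close>, but it takes the
  value \<open>1\<close> at arbitrarily small scales for some \<open>\<phi>\<close> in each \<open>\<A> q\<close>, so it is not null
  (\<open>frequent_zeros_zero_divisor\<close>). Finally, units never are zero divisors.
\<close>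

section \<open>Test functions have finite moment order\<close>

lemma test_fun_continuous: "\<phi> \<in> test_fun \<Longrightarrow> continuous_on UNIV \<phi>"
  using C_k.simps(1) unfolding test_fun_def smooth_def by blast

lemma test_fun_bounded_support:
  fixes \<phi> :: "real ^ 'n \<Rightarrow> complex"
  assumes "\<phi> \<in> test_fun"
  obtains R where "R > 0" "\<And>x. \<phi> x \<noteq> 0 \<Longrightarrow> norm x \<le> R"
proof -
  have "bounded {x. \<phi> x \<noteq> 0}"
    using assms compact_imp_bounded bounded_subset closure_subset unfolding test_fun_def by blast
  then show ?thesis
    using that unfolding bounded_pos by blast
qed

lemma test_fun_integrable:
  fixes \<phi> :: "real ^ 'n \<Rightarrow> complex"
  assumes "\<phi> \<in> test_fun" "continuous_on UNIV g"
  shows "integrable lborel (\<lambda>x. of_real (g x) * \<phi> x)"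
proof -
  obtain R where R: "\<And>x. \<phi> x \<noteq> 0 \<Longrightarrow> norm x \<le> R"
    using test_fun_bounded_support[OF assms(1)] by metis
  have "continuous_on (cball 0 R) (\<lambda>x. complex_of_real (g x) * \<phi> x)"
    using assms(2) test_fun_continuous[OF assms(1)]
    by (intro continuous_intros) (auto intro: continuous_on_subset)
  then have "integrable lborel (\<lambda>x. indicator (cball 0 R) x *\<^sub>R (of_real (g x) * \<phi> x))"
    by (intro borel_integrable_compact) auto
  also have "(\<lambda>x. indicator (cball 0 R) x *\<^sub>R (of_real (g x) * \<phi> x)) = (\<lambda>x. of_real (g x) * \<phi> x)"
  proof
    fix x
    show "indicator (cball 0 R) x *\<^sub>R (of_real (g x) * \<phi> x) = of_real (g x) * \<phi> x"
      using R[of x] by (cases "\<phi> x = 0") auto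
  qed
  finally show ?thesis .
qed

lemma coordinate_moment_eq_0:
  fixes \<phi> :: "real ^ 'n \<Rightarrow> complex"
  assumes "\<phi> \<in> \<A> k" "k \<ge> 1"
  shows "(LINT x|lborel. of_real ((x $ i) ^ k) * \<phi> x) = 0"
proof -
  let ?\<alpha> = "\<lambda>j. if j = i then k else 0"
  have "(\<Sum>j\<in>UNIV. ?\<alpha> j) = k"
    by simp
  then have "(LINT x|lborel. of_real (monomial ?\<alpha> x) * \<phi> x) = 0"
    using assms unfolding \<A>_def by auto
  moreover have "monomial ?\<alpha> x = (x $ i) ^ k" for x :: "real ^ 'n"
  proof -
    have "monomial ?\<alpha> x = (\<Prod>j\<in>UNIV. if j = i then (x $ i) ^ k else 1)"
      unfolding monomial_def by (intro prod.cong) auto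
    then show ?thesis
      by simp
  qed
  ultimately show ?thesis
    by simp
qed

text \<open>
  If all higher moments vanish, a polynomial in one coordinate integrates against \<open>\<phi>\<close> to its
  value at \<open>0\<close>. For a support in the ball of radius \<open>R\<close> the polynomials \<open>(1 - x\<^sub>i\<^sup>2 / R\<^sup>2)\<^sup>k\<close>
  have value \<open>1\<close> at \<open>0\<close>, but on the support they are bounded by \<open>1\<close> and tend to \<open>0\<close> off a
  hyperplane, so the integrals would also tend to \<open>0\<close>.
\<close>

lemma finite_moment_order:
  fixes \<phi> :: "real ^ 'n \<Rightarrow> complex"
  obtains q where "\<phi> \<notin> \<A> q"
proof (rule ccontr)
  assume "\<not> thesis"
  then have A: "\<phi> \<in> \<A> q" for q
    using that by blast
  then have tf: "\<phi> \<in> test_fun" and int1: "(LINT x|lborel. \<phi> x) = 1"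
    unfolding \<A>_def by auto
  obtain R where R: "R > 0" "\<And>x. \<phi> x \<noteq> 0 \<Longrightarrow> norm x \<le> R"
    using test_fun_bounded_support[OF tf] by metis
  obtain i :: 'n where True
    by blast
  \<comment> \<open>the normalised square of an arbitrary coordinate, with values in the unit interval on the support\<close>
  let ?t = "\<lambda>x::real ^ 'n. (x $ i)\<^sup>2 / R\<^sup>2"
  let ?p = "\<lambda>k x. (1 - ?t x) ^ k"
  have int_p: "(LINT x|lborel. of_real (?p k x) * \<phi> x) = 1" for k
  proof -
    let ?c = "\<lambda>j. real (k choose j) * (- 1 / R\<^sup>2) ^ j"
    let ?f = "\<lambda>j x. of_real (?c j) * (of_real ((x $ i) ^ (2 * j)) * \<phi> x)"
    have "?p k x = (\<Sum>j\<le>k. ?c j * (x $ i) ^ (2 * j))" for x :: "real ^ 'n"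
    proof -
      have "?p k x = (- 1 / R\<^sup>2 * (x $ i)\<^sup>2 + 1) ^ k"
        by simp
      also have "\<dots> = (\<Sum>j\<le>k. ?c j * (x $ i) ^ (2 * j))"
        unfolding binomial_ring by (intro sum.cong refl) (simp only: power_mult_distrib power_mult power_one mult_1_right mult.assoc)
      finally show ?thesis .
    qed
    then have "(LINT x|lborel. of_real (?p k x) * \<phi> x) = (LINT x|lborel. (\<Sum>j\<le>k. ?f j x))"
      by (simp add: sum_distrib_right mult.assoc)
    also have "\<dots> = (\<Sum>j\<le>k. LINT x|lborel. ?f j x)"
      by (intro Bochner_Integration.integral_sum integrable_mult_right test_fun_integrable[OF tf]
          continuous_intros)
    also have "\<dots> = (\<Sum>j\<le>k. if j = 0 then 1 else 0)"
    proof (intro sum.cong refl)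
      fix j
      show "(LINT x|lborel. ?f j x) = (if j = 0 then 1 else 0)"
        using coordinate_moment_eq_0[OF A, of "2 * j" i] int1 by (cases "j = 0") (simp_all del: of_real_power)
    qed
    finally show ?thesis
      by simp
  qed
  have t: "?t x \<le> 1" if "\<phi> x \<noteq> 0" for x
  proof -
    have "\<bar>x $ i\<bar> \<le> R"
      using component_le_norm_cart[of x i] R(2)[OF that] by linarith
    then show ?thesis
      using R(1) abs_le_square_iff[of "x $ i" R] by simp
  qed
  have "(\<lambda>k. LINT x|lborel. of_real (?p k x) * \<phi> x) \<longlonglongrightarrow> (LINT x|(lborel :: (real ^ 'n) measure). (0 :: complex))"
  proof (rule integral_dominated_convergence)
    have phi_int: "integrable lborel \<phi>"
      using test_fun_integrable[OF tf, of "\<lambda>_. 1"] by simp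
    then show "integrable lborel (\<lambda>x. cmod (\<phi> x))"
      by (rule integrable_norm)
    show "(\<lambda>x. complex_of_real (?p k x) * \<phi> x) \<in> borel_measurable lborel" for k
      by (intro borel_measurable_integrable test_fun_integrable[OF tf] continuous_intros) (use R in auto)
    show "AE x in lborel. cmod (of_real (?p k x) * \<phi> x) \<le> cmod (\<phi> x)" for k
    proof (rule AE_I2)
      fix x :: "real ^ 'n"
      show "cmod (of_real (?p k x) * \<phi> x) \<le> cmod (\<phi> x)"
      proof (cases "\<phi> x = 0")
        case False
        have "\<bar>?p k x\<bar> \<le> 1"
          using t[OF False] by (simp add: power_abs power_le_one)
        then show ?thesis
          by (simp only: norm_mult norm_of_real) (simp add: mult_left_le_one_le)
      qed simp
    qed
    have "AE x in lborel. x \<notin> {x :: real ^ 'n. x $ i = 0}"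
      using AE_not_in[OF negligible_standard_hyperplane_cart[of i, unfolded negligible_iff_null_sets]]
      unfolding AE_completion_iff .
    then show "AE x in lborel. (\<lambda>k. of_real (?p k x) * \<phi> x) \<longlonglongrightarrow> 0"
    proof (rule AE_mp, intro AE_I2 impI)
      fix x :: "real ^ 'n"
      assume x: "x \<notin> {x. x $ i = 0}"
      show "(\<lambda>k. of_real (?p k x) * \<phi> x) \<longlonglongrightarrow> 0"
      proof (cases "\<phi> x = 0")
        case False
        have "?t x > 0"
          using x R(1) by simp
        then have "\<bar>1 - ?t x\<bar> < 1"
          using t[OF False] unfolding abs_less_iff by linarith
        then have "(\<lambda>k. ?p k x) \<longlonglongrightarrow> 0"
          by (intro LIMSEQ_power_zero) (simp only: real_norm_def)
        then have "(\<lambda>k. complex_of_real (?p k x)) \<longlonglongrightarrow> of_real 0"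
          by (rule tendsto_of_real)
        then show ?thesis
          by (intro tendsto_mult_left_zero) simp
      qed simp
    qed
  qed simp_all
  then have "(\<lambda>k::nat. 1 :: complex) \<longlonglongrightarrow> 0"
    unfolding int_p by simp
  then show False
    using LIMSEQ_unique[OF tendsto_const] by fastforce
qed

section \<open>Dilations and the width of a test function\<close>

lemma dilate_in_A_iff:
  assumes "\<epsilon> > 0"
  shows "dilate \<epsilon> \<phi> \<in> \<A> q \<longleftrightarrow> \<phi> \<in> \<A> q"
proof
  have "dilate (1 / \<epsilon>) (dilate \<epsilon> \<phi>) = \<phi>"
    using assms by (auto simp: dilate_def power_int_minus power_int_of_nat field_simps)
  moreover assume "dilate \<epsilon> \<phi> \<in> \<A> q"
  then have "dilate (1 / \<epsilon>) (dilate \<epsilon> \<phi>) \<in> \<A> q"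
    by (rule dilate_in_A) (use assms in simp)
  ultimately show "\<phi> \<in> \<A> q"
    by simp
qed (use assms in \<open>auto intro: dilate_in_A\<close>)

text \<open>
  Any positive functional that dilation multiplies by a positive power of \<open>\<epsilon>\<close> would serve to
  read off the scale from \<open>S\<^sub>\<epsilon> \<phi>\<close> itself; the reciprocal of the supremum norm has
  exponent \<open>n\<close>.
\<close>

definition width :: "(real ^ 'n \<Rightarrow> complex) \<Rightarrow> real" where
  "width \<phi> = 1 / (SUP x. cmod (\<phi> x))"

text \<open>
  That the supremum is attained makes it finite and, since a function with integral \<open>1\<close> does not
  vanish identically, nonzero.
\<close>

lemma width_attained:
  fixes \<phi> :: "real ^ 'n \<Rightarrow> complex"
  assumes "\<phi> \<in> \<A> q"
  obtains x where "\<phi> x \<noteq> 0" "\<And>y. cmod (\<phi> y) \<le> cmod (\<phi> x)"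
proof -
  have tf: "\<phi> \<in> test_fun" and "(LINT x|lborel. \<phi> x) \<noteq> 0"
    using assms unfolding \<A>_def by auto
  then obtain z where z: "\<phi> z \<noteq> 0"
    using Bochner_Integration.integral_cong[of lborel lborel \<phi> "\<lambda>_. 0"] by auto
  obtain R where R: "R > 0" "\<And>x. \<phi> x \<noteq> 0 \<Longrightarrow> norm x \<le> R"
    using test_fun_bounded_support[OF tf] by metis
  have cont: "continuous_on (cball 0 R) (\<lambda>x. cmod (\<phi> x))"
    using test_fun_continuous[OF tf] by (intro continuous_on_norm) (auto intro: continuous_on_subset)
  obtain x where x: "\<forall>y\<in>cball 0 R. cmod (\<phi> y) \<le> cmod (\<phi> x)"
    using continuous_attains_sup[OF compact_cball _ cont] R(1) by auto
  have le: "cmod (\<phi> y) \<le> cmod (\<phi> x)" for y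
    using x R(2)[of y] by (cases "\<phi> y = 0") auto
  then have "\<phi> x \<noteq> 0"
    using z le[of z] by auto
  with le show ?thesis
    using that by blast
qed

lemma
  fixes \<phi> :: "real ^ 'n \<Rightarrow> complex"
  assumes "\<phi> \<in> \<A> q"
  shows width_pos: "width \<phi> > 0"
    and width_dilate: "\<epsilon> > 0 \<Longrightarrow> width (dilate \<epsilon> \<phi>) = \<epsilon> ^ CARD('n) * width \<phi>"
proof -
  obtain x where x: "\<phi> x \<noteq> 0" "\<And>y. cmod (\<phi> y) \<le> cmod (\<phi> x)"
    using width_attained[OF assms] by metis
  have "(SUP y. cmod (\<phi> y)) = cmod (\<phi> x)"
    using x(2) by (intro cSup_eq_maximum) auto
  then have width: "width \<phi> = 1 / cmod (\<phi> x)"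
    by (simp add: width_def)
  then show "width \<phi> > 0"
    using x(1) by simp
  assume \<epsilon>: "\<epsilon> > 0"
  have "(SUP y. cmod (dilate \<epsilon> \<phi> y)) = cmod (dilate \<epsilon> \<phi> (\<epsilon> *\<^sub>R x))"
  proof (rule cSup_eq_maximum)
    fix c assume "c \<in> range (\<lambda>y. cmod (dilate \<epsilon> \<phi> y))"
    then show "c \<le> cmod (dilate \<epsilon> \<phi> (\<epsilon> *\<^sub>R x))"
      using x(2) \<epsilon> by (auto simp: dilate_def norm_mult intro!: mult_left_mono)
  qed (rule rangeI)
  also have "\<dots> = \<epsilon> powi (- int CARD('n)) * cmod (\<phi> x)"
    using \<epsilon> by (simp add: dilate_def norm_mult norm_power_int)
  finally show "width (dilate \<epsilon> \<phi>) = \<epsilon> ^ CARD('n) * width \<phi>"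
    using \<epsilon> x(1)
    by (simp add: width width_def[of "dilate \<epsilon> \<phi>"] power_int_minus power_int_of_nat divide_inverse)
qed

section \<open>Arithmetic in the quotient\<close>

lemma C_mod_ring_simps:
  "carrier C_mod_ring = C_mod"
  "mult C_mod_ring r s = (\<lambda>\<phi>\<in>\<A> 0. r \<phi> * s \<phi>)"
  "add C_mod_ring r s = (\<lambda>\<phi>\<in>\<A> 0. r \<phi> + s \<phi>)"
  "one C_mod_ring = (\<lambda>\<phi>\<in>\<A> 0. 1)"
  "zero C_mod_ring = (\<lambda>\<phi>\<in>\<A> 0. 0)"
  by (simp_all add: C_mod_ring_def)

lemma C_mod_ring_minus:
  fixes r s :: "(real ^ 'n \<Rightarrow> complex) \<Rightarrow> complex"
  assumes "r \<in> C_mod" "s \<in> C_mod"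
  shows "r \<ominus>\<^bsub>C_mod_ring\<^esub> s = (\<lambda>\<phi>\<in>\<A> 0. r \<phi> - s \<phi>)"
proof -
  interpret cring "C_mod_ring :: ((real ^ 'n \<Rightarrow> complex) \<Rightarrow> complex) ring"
    by (rule cring_C_mod_ring)
  let ?t = "\<lambda>\<phi>\<in>\<A> 0. (\<lambda>\<phi>\<in>\<A> 0. - 1) \<phi> * s \<phi>"
  have "?t \<in> C_mod"
    using assms by (intro C_mod_mult C_mod_const)
  then have "\<ominus>\<^bsub>C_mod_ring\<^esub> s = ?t"
    using assms by (intro minus_equality) (auto simp: C_mod_ring_simps)
  then show ?thesis
    unfolding a_minus_def by (auto simp: C_mod_ring_simps)
qed

abbreviation gen_class ::
    "((real ^ 'n \<Rightarrow> complex) \<Rightarrow> complex) \<Rightarrow> ((real ^ 'n \<Rightarrow> complex) \<Rightarrow> complex) set" where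
  "gen_class r \<equiv> C_null +>\<^bsub>C_mod_ring\<^esub> r"

lemma gen_class_eq_iff:
  fixes r s :: "(real ^ 'n \<Rightarrow> complex) \<Rightarrow> complex"
  assumes "r \<in> C_mod" "s \<in> C_mod"
  shows "gen_class r = gen_class s \<longleftrightarrow> (\<lambda>\<phi>\<in>\<A> 0. r \<phi> - s \<phi>) \<in> C_null"
  using ring.quotient_eq_iff_same_a_r_cos[OF cring.axioms(1)[OF cring_C_mod_ring] ideal_C_null, of r s]
    C_mod_ring_minus[OF assms] assms by (simp add: C_mod_ring_simps)

lemma cring_C_gen: "cring (C_gen :: ((real ^ 'n \<Rightarrow> complex) \<Rightarrow> complex) set ring)"
  unfolding C_gen_def by (rule ideal.quotient_is_cring[OF ideal_C_null cring_C_mod_ring])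

lemma gen_class_in_carrier: "r \<in> C_mod \<Longrightarrow> gen_class r \<in> carrier C_gen"
  using ring_hom_closed[OF ideal.rcos_ring_hom[OF ideal_C_null], of r]
  by (simp add: C_gen_def C_mod_ring_simps)

lemma gen_class_mult:
  "r \<in> C_mod \<Longrightarrow> s \<in> C_mod \<Longrightarrow> gen_class r \<otimes>\<^bsub>C_gen\<^esub> gen_class s = gen_class (\<lambda>\<phi>\<in>\<A> 0. r \<phi> * s \<phi>)"
  using ring_hom_mult[OF ideal.rcos_ring_hom[OF ideal_C_null], of r s]
  by (simp add: C_gen_def C_mod_ring_simps)

lemma C_gen_one: "\<one>\<^bsub>C_gen\<^esub> = gen_class (\<lambda>\<phi>\<in>\<A> 0. 1)"
  using ring_hom_one[OF ideal.rcos_ring_hom[OF ideal_C_null], symmetric]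
  by (simp add: C_gen_def C_mod_ring_simps)

lemma C_gen_zero: "\<zero>\<^bsub>C_gen\<^esub> = gen_class (\<lambda>\<phi>\<in>\<A> 0. 0)"
  using ring_hom_zero[OF ideal.rcos_ring_hom[OF ideal_C_null] cring.axioms(1)[OF cring_C_mod_ring]
      ideal.quotient_is_ring[OF ideal_C_null], symmetric]
  by (simp add: C_gen_def C_mod_ring_simps)

lemma C_gen_cases:
  assumes "X \<in> carrier C_gen"
  obtains r where "r \<in> C_mod" "X = gen_class r"
  using assms by (auto simp: C_gen_def FactRing_def A_RCOSETS_def' C_mod_ring_simps a_r_coset_def)

lemma gen_class_memI:
  fixes r s :: "(real ^ 'n \<Rightarrow> complex) \<Rightarrow> complex"
  assumes "r \<in> C_mod" "s \<in> C_mod" "gen_class r = gen_class s"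
  shows "s \<in> gen_class r"
proof -
  interpret ideal C_null "C_mod_ring :: ((real ^ 'n \<Rightarrow> complex) \<Rightarrow> complex) ring"
    by (rule ideal_C_null)
  show ?thesis
    using assms a_rcos_self[of s] by (simp add: C_mod_ring_simps)
qed

lemma gen_class_memD:
  fixes r s :: "(real ^ 'n \<Rightarrow> complex) \<Rightarrow> complex"
  assumes "r \<in> C_mod" "s \<in> gen_class r"
  shows "s \<in> C_mod" "gen_class s = gen_class r"
proof -
  interpret ideal C_null "C_mod_ring :: ((real ^ 'n \<Rightarrow> complex) \<Rightarrow> complex) ring"
    by (rule ideal_C_null)
  have "gen_class r \<subseteq> carrier C_mod_ring"
    using assms(1) by (intro a_r_coset_subset_G a_subset) (simp add: C_mod_ring_simps)
  then show "s \<in> C_mod"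
    using assms(2) by (auto simp: C_mod_ring_simps)
  show "gen_class s = gen_class r"
    using a_repr_independence[OF assms(2) _ is_additive_subgroup[THEN additive_subgroup.a_subgroup]] assms(1)
    by (auto simp: C_mod_ring_simps)
qed

text \<open>
  The constant may depend on \<open>\<phi>\<close>, which is what allows the width of \<open>\<phi>\<close> to enter it later.
\<close>

lemma C_nullI:
  fixes r :: "(real ^ 'n \<Rightarrow> complex) \<Rightarrow> complex"
  assumes "\<And>m. \<exists>q\<ge>1. \<forall>\<phi>\<in>\<A> q. \<exists>C. \<forall>\<^sub>F \<epsilon> in at_right 0. cmod (r (dilate \<epsilon> \<phi>)) \<le> C * \<epsilon> ^ m"
  shows "restrict r (\<A> 0) \<in> C_null"
  unfolding C_null_iff
proof (intro conjI allI)
  fix m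
  obtain q where q: "q \<ge> 1" "\<And>\<phi>. \<phi> \<in> \<A> q \<Longrightarrow> \<exists>C. \<forall>\<^sub>F \<epsilon> in at_right 0. cmod (r (dilate \<epsilon> \<phi>)) \<le> C * \<epsilon> ^ m"
    using assms by blast
  have "(\<lambda>\<epsilon>. cmod (restrict r (\<A> 0) (dilate \<epsilon> \<phi>))) \<in> O[at_right 0](\<lambda>\<epsilon>. \<epsilon> powi int m)"
    if \<phi>: "\<phi> \<in> \<A> q" for \<phi>
  proof -
    obtain C where C: "\<forall>\<^sub>F \<epsilon> in at_right 0. cmod (r (dilate \<epsilon> \<phi>)) \<le> C * \<epsilon> ^ m"
      using q(2)[OF \<phi>] by blast
    show ?thesis
      unfolding bigo_restrict_A0[OF \<phi>]
    proof (rule bigoI)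
      show "\<forall>\<^sub>F \<epsilon> in at_right 0. norm (cmod (r (dilate \<epsilon> \<phi>))) \<le> C * norm (\<epsilon> powi int m)"
        using C eventually_at_right_less[of 0] by eventually_elim (simp add: power_int_of_nat)
    qed
  qed
  then show "\<exists>q\<ge>1. \<forall>\<phi>\<in>\<A> q.
      (\<lambda>\<epsilon>. cmod (restrict r (\<A> 0) (dilate \<epsilon> \<phi>))) \<in> O[at_right 0](\<lambda>\<epsilon>. \<epsilon> powi int m)"
    using q(1) by blast
qed auto

section \<open>Invertibility\<close>

text \<open>
  Near \<open>\<epsilon> = 0\<close> the lower bound excludes zeros of \<open>r\<close>, so the pointwise inverse is a true
  inverse there; the values at larger scales, among them the convention that zero is its own
  inverse, do not affect the class.
\<close>

lemma gen_class_UnitsI: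
  fixes r :: "(real ^ 'n \<Rightarrow> complex) \<Rightarrow> complex"
  assumes r: "r \<in> C_mod"
    and lower: "\<And>\<phi>. \<phi> \<in> \<A> N \<Longrightarrow> \<exists>C>0. \<forall>\<^sub>F \<epsilon> in at_right 0. C * \<epsilon> ^ N \<le> cmod (r (dilate \<epsilon> \<phi>))"
  shows "gen_class r \<in> Units C_gen"
proof -
  interpret cring "C_gen :: ((real ^ 'n \<Rightarrow> complex) \<Rightarrow> complex) set ring"
    by (rule cring_C_gen)
  let ?s = "\<lambda>\<phi>\<in>\<A> 0. inverse (r \<phi>)"
  have "(\<lambda>\<epsilon>. cmod (?s (dilate \<epsilon> \<phi>))) \<in> O[at_right 0](\<lambda>\<epsilon>. \<epsilon> powi (- int N))" if \<phi>: "\<phi> \<in> \<A> N" for \<phi>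
    unfolding bigo_restrict_A0[OF \<phi>]
  proof -
    obtain C where C: "C > 0" "\<forall>\<^sub>F \<epsilon> in at_right 0. C * \<epsilon> ^ N \<le> cmod (r (dilate \<epsilon> \<phi>))"
      using lower[OF \<phi>] by blast
    show "(\<lambda>\<epsilon>. cmod (inverse (r (dilate \<epsilon> \<phi>)))) \<in> O[at_right 0](\<lambda>\<epsilon>. \<epsilon> powi (- int N))"
    proof (rule bigoI)
      show "\<forall>\<^sub>F \<epsilon> in at_right 0. norm (cmod (inverse (r (dilate \<epsilon> \<phi>)))) \<le>
          inverse C * norm (\<epsilon> powi (- int N))"
        using C(2) eventually_at_right_less[of 0]
      proof eventually_elim
        case (elim \<epsilon>)
        then have "inverse (cmod (r (dilate \<epsilon> \<phi>))) \<le> inverse (C * \<epsilon> ^ N)"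
          using C(1) by (intro le_imp_inverse_le) auto
        then show ?case
          using elim by (simp add: norm_inverse power_int_minus power_int_of_nat)
      qed
    qed
  qed
  then have s: "?s \<in> C_mod"
    unfolding C_mod_iff by (auto simp del: restrict_apply)
  have "(\<lambda>\<phi>\<in>\<A> 0. (\<lambda>\<phi>\<in>\<A> 0. r \<phi> * ?s \<phi>) \<phi> - (\<lambda>\<phi>\<in>\<A> 0. 1) \<phi>) =
      (\<lambda>\<phi>\<in>\<A> 0. r \<phi> * inverse (r \<phi>) - 1)"
    by (auto intro!: restrict_ext)
  also have "\<dots> \<in> C_null"
  proof (rule C_nullI)
    fix m
    have "\<exists>C. \<forall>\<^sub>F \<epsilon> in at_right 0.
        cmod (r (dilate \<epsilon> \<phi>) * inverse (r (dilate \<epsilon> \<phi>)) - 1) \<le> C * \<epsilon> ^ m"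
      if "\<phi> \<in> \<A> (Suc N)" for \<phi>
    proof -
      have "\<phi> \<in> \<A> N"
        using that A_mono[of N "Suc N"] by auto
      then obtain C where C: "C > 0" "\<forall>\<^sub>F \<epsilon> in at_right 0. C * \<epsilon> ^ N \<le> cmod (r (dilate \<epsilon> \<phi>))"
        using lower by blast
      have "\<forall>\<^sub>F \<epsilon> in at_right 0. cmod (r (dilate \<epsilon> \<phi>) * inverse (r (dilate \<epsilon> \<phi>)) - 1) \<le> 0 * \<epsilon> ^ m"
        using C(2) eventually_at_right_less[of 0]
      proof eventually_elim
        case (elim \<epsilon>)
        then have "0 < cmod (r (dilate \<epsilon> \<phi>))"
          using C(1) by (intro less_le_trans[OF _ elim(1)]) simp
        then show ?case
          by simp
      qed
      then show ?thesis ..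
    qed
    then show "\<exists>q\<ge>1. \<forall>\<phi>\<in>\<A> q. \<exists>C. \<forall>\<^sub>F \<epsilon> in at_right 0.
        cmod (r (dilate \<epsilon> \<phi>) * inverse (r (dilate \<epsilon> \<phi>)) - 1) \<le> C * \<epsilon> ^ m"
      by (intro exI[of _ "Suc N"]) auto
  qed
  finally have "gen_class (\<lambda>\<phi>\<in>\<A> 0. r \<phi> * ?s \<phi>) = gen_class (\<lambda>\<phi>\<in>\<A> 0. 1)"
    by (simp only: gen_class_eq_iff[OF C_mod_mult[OF r s] C_mod_const])
  then have "gen_class r \<otimes>\<^bsub>C_gen\<^esub> gen_class ?s = \<one>\<^bsub>C_gen\<^esub>"
    by (simp add: gen_class_mult[OF r s] C_gen_one)
  moreover have "gen_class r \<in> carrier C_gen" "gen_class ?s \<in> carrier C_gen"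
    using gen_class_in_carrier r s by blast+
  ultimately show ?thesis
    unfolding Units_def using m_comm by force
qed

lemma zero_divisor_not_Unit:
  assumes "cring R" "zero_divisor R a"
  shows "a \<notin> Units R"
proof
  interpret cring R
    by fact
  assume u: "a \<in> Units R"
  obtain b where b: "b \<in> carrier R" "b \<noteq> \<zero>\<^bsub>R\<^esub>" "a \<otimes>\<^bsub>R\<^esub> b = \<zero>\<^bsub>R\<^esub>"
    using assms(2) unfolding zero_divisor_def by blast
  have "a \<otimes>\<^bsub>R\<^esub> b = a \<otimes>\<^bsub>R\<^esub> \<zero>\<^bsub>R\<^esub>"
    using b(3) r_null[OF Units_closed[OF u]] by simp
  then show False
    using b(2) Units_l_cancel[OF u b(1) zero_closed] by simp
qed

section \<open>Representatives with many zeros\<close>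

lemma frequently_at_right_0_seq:
  fixes P :: "real \<Rightarrow> bool"
  assumes "\<exists>\<^sub>F \<epsilon> in at_right 0. P \<epsilon>"
  obtains \<epsilon> :: "nat \<Rightarrow> real" where "strict_antimono_on UNIV \<epsilon>" "\<And>k. \<epsilon> k > 0" "\<epsilon> \<longlonglongrightarrow> 0" "\<And>k. P (\<epsilon> k)"
proof -
  have ex: "\<exists>x. 0 < x \<and> x < b \<and> P x" if "b > 0" for b
    using assms that unfolding frequently_def eventually_at_right_field by blast
  have "\<exists>\<epsilon>. \<forall>k. (0 < \<epsilon> k \<and> \<epsilon> k < 1 / (real k + 1) \<and> P (\<epsilon> k)) \<and> \<epsilon> (Suc k) < \<epsilon> k"
  proof (rule dependent_nat_choice)
    show "\<exists>x. 0 < x \<and> x < 1 / (real 0 + 1) \<and> P x"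
      using ex[of 1] by simp
    fix x :: real and k
    assume "0 < x \<and> x < 1 / (real k + 1) \<and> P x"
    then show "\<exists>y. (0 < y \<and> y < 1 / (real (Suc k) + 1) \<and> P y) \<and> y < x"
      using ex[of "min x (1 / (real (Suc k) + 1))"] by auto
  qed
  then obtain \<epsilon> where \<epsilon>: "\<And>k. 0 < \<epsilon> k" "\<And>k. \<epsilon> k < 1 / (real k + 1)" "\<And>k. P (\<epsilon> k)"
    "\<And>k. \<epsilon> (Suc k) < \<epsilon> k"
    by blast
  have "\<epsilon> \<longlonglongrightarrow> 0"
  proof (rule tendsto_sandwich[of "\<lambda>_. 0" \<epsilon> _ "\<lambda>k. 1 / (real k + 1)"])
    show "(\<lambda>k. 1 / (real k + 1)) \<longlonglongrightarrow> 0"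
      using LIMSEQ_inverse_real_of_nat by (simp add: inverse_eq_divide add.commute)
    show "\<forall>\<^sub>F k in sequentially. 0 \<le> \<epsilon> k" "\<forall>\<^sub>F k in sequentially. \<epsilon> k \<le> 1 / (real k + 1)"
      using \<epsilon>(1,2) by (auto intro: always_eventually less_imp_le)
  qed auto
  moreover have "\<epsilon> m < \<epsilon> l" if "l < m" for l m
    using lift_Suc_mono_less[of "\<lambda>k. - \<epsilon> k", OF _ that] \<epsilon>(4) by simp
  then have "strict_antimono_on UNIV \<epsilon>"
    by (simp add: monotone_on_def)
  ultimately show ?thesis
    using that \<epsilon> by blast
qed

definition frequent_zeros :: "((real ^ 'n \<Rightarrow> complex) \<Rightarrow> complex) \<Rightarrow> bool" where
  "frequent_zeros r \<longleftrightarrow> (\<forall>q\<ge>1. \<exists>\<phi>\<in>\<A> q. \<exists>\<epsilon> :: nat \<Rightarrow> real.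
     strict_antimono_on UNIV \<epsilon> \<and> (\<forall>k. \<epsilon> k > 0) \<and> \<epsilon> \<longlonglongrightarrow> 0 \<and> (\<forall>k. r (dilate (\<epsilon> k) \<phi>) = 0))"

text \<open>
  Choose levels \<open>l 0 < l 1 < \<dots>\<close> such that each layer \<open>\<A> (l j) - \<A> (l (j + 1))\<close> contains a
  function \<open>\<phi>\<close> with \<open>\<bar>r(S\<^sub>\<epsilon> \<phi>)\<bar> < width (S\<^sub>\<epsilon> \<phi>) ^ l j\<close> for arbitrarily small \<open>\<epsilon>\<close>; finiteness of the
  moment order yields the next level. In each layer put \<open>r\<close> to \<open>0\<close> wherever this inequality
  holds. A function in \<open>\<A> (l (m + 1))\<close> lies in no layer \<open>j < m\<close>, and layers are dilation
  invariant, so along its dilations the change is of order \<open>\<epsilon> ^ m\<close>.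
\<close>

lemma non_unit_representative:
  fixes r :: "(real ^ 'n \<Rightarrow> complex) \<Rightarrow> complex"
  assumes r: "r \<in> C_mod" and non_unit: "gen_class r \<notin> Units C_gen"
  shows "\<exists>s\<in>gen_class r. frequent_zeros s"
proof -
  let ?n = "CARD('n)"
  let ?small = "\<lambda>q \<phi>. \<exists>\<^sub>F \<epsilon> in at_right 0. cmod (r (dilate \<epsilon> \<phi>)) < width (dilate \<epsilon> \<phi>) ^ q"
  have ex: "\<exists>\<phi>\<in>\<A> q. ?small q \<phi>" for q
  proof -
    \<comment> \<open>the \<open>q\<close>-th power of the width has order \<open>n * q\<close> in \<open>\<epsilon>\<close>\<close>
    let ?N = "?n * q"
    obtain \<phi> where \<phi>: "\<phi> \<in> \<A> ?N" and
      freq: "\<And>C. C > 0 \<Longrightarrow> \<exists>\<^sub>F \<epsilon> in at_right 0. cmod (r (dilate \<epsilon> \<phi>)) < C * \<epsilon> ^ ?N"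
      using gen_class_UnitsI[OF r, of ?N] non_unit by (auto simp: frequently_def not_less)
    have "width \<phi> ^ q > 0"
      using width_pos[OF \<phi>] by simp
    then have "\<exists>\<^sub>F \<epsilon> in at_right 0. cmod (r (dilate \<epsilon> \<phi>)) < width \<phi> ^ q * \<epsilon> ^ ?N"
      by (rule freq)
    then have "?small q \<phi>"
    proof (rule frequently_rev_mp)
      show "\<forall>\<^sub>F \<epsilon> in at_right 0. cmod (r (dilate \<epsilon> \<phi>)) < width \<phi> ^ q * \<epsilon> ^ ?N \<longrightarrow>
          cmod (r (dilate \<epsilon> \<phi>)) < width (dilate \<epsilon> \<phi>) ^ q"
        using eventually_at_right_less[of 0]
        by eventually_elim (simp add: width_dilate[OF \<phi>] power_mult_distrib mult.commute flip: power_mult)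
    qed
    moreover have "\<phi> \<in> \<A> q"
      using \<phi> A_mono[of q ?N] by auto
    ultimately show ?thesis
      by blast
  qed
  have "\<forall>q. \<exists>p. q < p \<and> (\<exists>\<phi>\<in>\<A> q - \<A> p. ?small q \<phi>)"
  proof
    fix q
    obtain \<phi> where \<phi>: "\<phi> \<in> \<A> q" "?small q \<phi>"
      using ex by blast
    obtain p where p: "\<phi> \<notin> \<A> p"
      by (rule finite_moment_order)
    moreover have "p > q"
      using \<phi>(1) p A_mono[of p q] by (cases "p \<le> q") auto
    ultimately show "\<exists>p. q < p \<and> (\<exists>\<phi>\<in>\<A> q - \<A> p. ?small q \<phi>)"
      using \<phi> by blast
  qed
  from choice[OF this] obtain p
    where p: "\<And>q. q < p q" "\<And>q. \<exists>\<phi>\<in>\<A> q - \<A> (p q). ?small q \<phi>"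
    by blast
  define l where "l j = (p ^^ j) 0" for j
  have l_Suc: "l (Suc j) = p (l j)" for j
    by (simp add: l_def)
  have "strict_mono l"
    by (simp add: strict_mono_Suc_iff l_Suc p(1))
  then have l_ge: "j \<le> l j" for j
    by (rule strict_mono_imp_increasing)
  \<comment> \<open>\<open>r = s + d\<close>, where \<open>Z\<close> collects the small values of \<open>r\<close>, which \<open>d\<close> takes away\<close>
  define Z where "Z = {\<psi>. \<exists>j. \<psi> \<in> \<A> (l j) - \<A> (l (Suc j)) \<and> cmod (r \<psi>) < width \<psi> ^ l j}"
  define s where "s = (\<lambda>\<psi>\<in>\<A> 0. if \<psi> \<in> Z then 0 else r \<psi>)"
  define d where "d = (\<lambda>\<psi>\<in>\<A> 0. if \<psi> \<in> Z then r \<psi> else 0)"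
  have d_null: "d \<in> C_null"
    unfolding d_def
  proof (rule C_nullI)
    fix m
    have "\<exists>C. \<forall>\<^sub>F \<epsilon> in at_right 0.
        cmod (if dilate \<epsilon> \<phi> \<in> Z then r (dilate \<epsilon> \<phi>) else 0) \<le> C * \<epsilon> ^ m"
      if \<phi>: "\<phi> \<in> \<A> (l (Suc m))" for \<phi>
    proof (intro exI)
      \<comment> \<open>below these scales the dilates have width at most \<open>1\<close>, so larger exponents give smaller bounds\<close>
      have "\<forall>\<^sub>F \<epsilon> in at_right 0. \<epsilon> < min 1 (1 / width \<phi>)"
        using width_pos[OF \<phi>] by (intro order_tendstoD(2)[OF tendsto_ident_at]) simp
      then show "\<forall>\<^sub>F \<epsilon> in at_right 0.
          cmod (if dilate \<epsilon> \<phi> \<in> Z then r (dilate \<epsilon> \<phi>) else 0) \<le> width \<phi> ^ m * \<epsilon> ^ m"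
        using eventually_at_right_less[of 0]
      proof eventually_elim
        case (elim \<epsilon>)
        have width_le: "width (dilate \<epsilon> \<phi>) \<le> width \<phi> * \<epsilon>"
          using elim width_pos[OF \<phi>] power_decreasing[of 1 ?n \<epsilon>] 
          by (simp add: width_dilate[OF \<phi>] mult.commute)
        also have "\<dots> \<le> 1"
          using elim width_pos[OF \<phi>] by (simp add: field_simps)
        finally have width_le_1: "width (dilate \<epsilon> \<phi>) \<le> 1" .
        have dA: "dilate \<epsilon> \<phi> \<in> \<A> (l (Suc m))"
          using dilate_in_A[OF \<phi>] elim by blast
        have width_nonneg: "0 \<le> width (dilate \<epsilon> \<phi>)"
          using width_pos[OF dA] by simp
        have "cmod (r (dilate \<epsilon> \<phi>)) \<le> width \<phi> ^ m * \<epsilon> ^ m" if Z: "dilate \<epsilon> \<phi> \<in> Z"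
        proof -
          obtain j where j: "dilate \<epsilon> \<phi> \<notin> \<A> (l (Suc j))" "cmod (r (dilate \<epsilon> \<phi>)) < width (dilate \<epsilon> \<phi>) ^ l j"
            using Z unfolding Z_def by blast
          have "m \<le> j"
          proof (rule ccontr)
            assume "\<not> m \<le> j"
            then have "l (Suc j) \<le> l (Suc m)"
              using strict_mono_less_eq[OF \<open>strict_mono l\<close>] by simp
            then show False
              using A_mono dA j(1) by blast
          qed
          then have "width (dilate \<epsilon> \<phi>) ^ l j \<le> width (dilate \<epsilon> \<phi>) ^ m"
            using width_nonneg width_le_1 l_ge[of j] by (intro power_decreasing) auto
          also have "\<dots> \<le> (width \<phi> * \<epsilon>) ^ m"
            using width_nonneg width_le by (intro power_mono)
          finally show ?thesis
            using j(2) by (simp add: power_mult_distrib)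
        qed
        then show ?case
          using elim width_pos[OF \<phi>] by simp
      qed
    qed
    then show "\<exists>q\<ge>1. \<forall>\<phi>\<in>\<A> q. \<exists>C. \<forall>\<^sub>F \<epsilon> in at_right 0.
        cmod (if dilate \<epsilon> \<phi> \<in> Z then r (dilate \<epsilon> \<phi>) else 0) \<le> C * \<epsilon> ^ m"
      using l_ge[of "Suc m"] by (intro exI[of _ "l (Suc m)"]) auto
  qed
  have s_eq: "s = (\<lambda>\<phi>\<in>\<A> 0. r \<phi> + (\<lambda>\<phi>\<in>\<A> 0. (\<lambda>\<phi>\<in>\<A> 0. - 1) \<phi> * d \<phi>) \<phi>)"
    by (auto simp: s_def d_def intro!: restrict_ext)
  have s: "s \<in> C_mod"
    unfolding s_eq using d_null C_null_subset
    by (intro C_mod_add C_mod_mult C_mod_const r) auto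
  have "(\<lambda>\<phi>\<in>\<A> 0. r \<phi> - s \<phi>) = d"
    by (auto simp: s_def d_def)
  then have "s \<in> gen_class r"
    using d_null gen_class_eq_iff[OF r s] gen_class_memI[OF r s] by simp
  moreover have "frequent_zeros s"
    unfolding frequent_zeros_def
  proof (intro allI impI)
    fix q :: nat
    obtain \<phi> where \<phi>: "\<phi> \<in> \<A> (l q)" "\<phi> \<notin> \<A> (l (Suc q))" and small: "?small (l q) \<phi>"
      using p(2)[of "l q"] unfolding l_Suc by blast
    obtain \<epsilon> where \<epsilon>: "strict_antimono_on UNIV \<epsilon>" "\<And>k. \<epsilon> k > 0" "\<epsilon> \<longlonglongrightarrow> 0"
      "\<And>k. cmod (r (dilate (\<epsilon> k) \<phi>)) < width (dilate (\<epsilon> k) \<phi>) ^ l q"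
      using frequently_at_right_0_seq[OF small] by blast
    have "s (dilate (\<epsilon> k) \<phi>) = 0" for k
    proof -
      have "dilate (\<epsilon> k) \<phi> \<in> \<A> (l q)"
        using \<phi>(1) \<epsilon>(2) by (intro dilate_in_A)
      moreover have "dilate (\<epsilon> k) \<phi> \<notin> \<A> (l (Suc q))"
        using \<phi>(2) \<epsilon>(2) dilate_in_A_iff by blast
      ultimately have "dilate (\<epsilon> k) \<phi> \<in> Z" "dilate (\<epsilon> k) \<phi> \<in> \<A> 0"
        using \<epsilon>(4)[of k] A_mono[of 0 "l q"] unfolding Z_def by blast+
      then show ?thesis
        by (simp add: s_def)
    qed
    then show "\<exists>\<phi>\<in>\<A> q. \<exists>\<epsilon> :: nat \<Rightarrow> real. strict_antimono_on UNIV \<epsilon> \<and> (\<forall>k. \<epsilon> k > 0) \<and> \<epsilon> \<longlonglongrightarrow> 0 \<and>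
        (\<forall>k. s (dilate (\<epsilon> k) \<phi>) = 0)"
      using \<phi>(1) \<epsilon> A_mono[OF l_ge[of q]] by blast
  qed
  ultimately show ?thesis
    by blast
qed

lemma frequent_zeros_zero_divisor:
  fixes r :: "(real ^ 'n \<Rightarrow> complex) \<Rightarrow> complex"
  assumes r: "r \<in> C_mod" and zeros: "frequent_zeros r"
  shows "zero_divisor C_gen (gen_class r)"
proof -
  let ?s = "\<lambda>\<phi>\<in>\<A> 0. if r \<phi> = 0 then 1 else 0 :: complex"
  have bd: "(\<lambda>\<epsilon>. cmod (?s (dilate \<epsilon> \<phi>))) \<in> O[at_right 0](\<lambda>\<epsilon>. \<epsilon> powi (- int 0))" if "\<phi> \<in> \<A> 0" for \<phi>
    unfolding bigo_restrict_A0[OF that] by (rule bigoI[of _ 1]) simp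
  then have s: "?s \<in> C_mod"
    unfolding C_mod_iff by (auto simp del: restrict_apply intro!: exI[of _ 0])
  have "?s \<notin> C_null"
  proof
    assume "?s \<in> C_null"
    then obtain q where q: "q \<ge> 1" "\<And>\<phi>. \<phi> \<in> \<A> q \<Longrightarrow>
        (\<lambda>\<epsilon>. cmod (?s (dilate \<epsilon> \<phi>))) \<in> O[at_right 0](\<lambda>\<epsilon>. \<epsilon> powi int 1)"
      unfolding C_null_iff by meson
    obtain \<phi> and \<epsilon> :: "nat \<Rightarrow> real" where \<phi>: "\<phi> \<in> \<A> q" and
      \<epsilon>: "\<And>k. \<epsilon> k > 0" "\<epsilon> \<longlonglongrightarrow> 0" "\<And>k. r (dilate (\<epsilon> k) \<phi>) = 0"
      using zeros q(1) unfolding frequent_zeros_def by blast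
    obtain c where "\<forall>\<^sub>F \<epsilon> in at_right 0. norm (cmod (?s (dilate \<epsilon> \<phi>))) \<le> c * norm (\<epsilon> powi int 1)"
      using q(2)[OF \<phi>] by (elim landau_o.bigE)
    moreover have "((\<lambda>\<epsilon>::real. c * norm (\<epsilon> powi int 1)) \<longlongrightarrow> 0) (at_right 0)"
      by (auto intro!: tendsto_eq_intros)
    ultimately have "((\<lambda>\<epsilon>. cmod (?s (dilate \<epsilon> \<phi>))) \<longlongrightarrow> 0) (at_right 0)"
      by (rule Lim_null_comparison)
    moreover have "filterlim \<epsilon> (at_right 0) sequentially"
      using \<epsilon>(1,2) less_imp_neq[OF \<epsilon>(1)] by (auto simp: filterlim_at)
    ultimately have "(\<lambda>k. cmod (?s (dilate (\<epsilon> k) \<phi>))) \<longlonglongrightarrow> 0"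
      by (rule filterlim_compose)
    moreover have "cmod (?s (dilate (\<epsilon> k) \<phi>)) = 1" for k
      using \<epsilon>(3)[of k] dilate_in_A[OF \<phi> \<epsilon>(1)[of k]] A_mono[of 0 q] by auto
    ultimately show False
      by (simp only: LIMSEQ_const_iff zero_neq_one[symmetric])
  qed
  moreover have "(\<lambda>\<phi>\<in>\<A> 0. ?s \<phi> - (\<lambda>\<phi>\<in>\<A> 0. 0) \<phi>) = ?s"
    by (rule restrict_ext) simp
  ultimately have "gen_class ?s \<noteq> \<zero>\<^bsub>C_gen\<^esub>"
    by (simp only: C_gen_zero gen_class_eq_iff[OF s C_mod_const] not_False_eq_True)
  moreover have "(\<lambda>\<phi>\<in>\<A> 0. r \<phi> * ?s \<phi>) = (\<lambda>\<phi>\<in>\<A> 0. 0)"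
    by (auto intro!: restrict_ext)
  then have "gen_class r \<otimes>\<^bsub>C_gen\<^esub> gen_class ?s = \<zero>\<^bsub>C_gen\<^esub>"
    by (simp only: gen_class_mult[OF r s] C_gen_zero)
  ultimately show ?thesis
    unfolding zero_divisor_def using gen_class_in_carrier r s by blast
qed

theorem proposition19:
  fixes X :: "((real ^ 'n \<Rightarrow> complex) \<Rightarrow> complex) set"
  assumes "X \<in> carrier C_gen"
  shows "(X \<notin> Units C_gen \<longleftrightarrow>
           (\<exists>r\<in>X. \<forall>q\<ge>1. \<exists>\<phi>\<in>\<A> q. \<exists>\<epsilon> :: nat \<Rightarrow> real.
              strict_antimono_on UNIV \<epsilon> \<and> (\<forall>k. \<epsilon> k > 0) \<and> \<epsilon> \<longlonglongrightarrow> 0 \<and>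
              (\<forall>k. r (dilate (\<epsilon> k) \<phi>) = 0)))
       \<and> (X \<notin> Units C_gen \<longleftrightarrow> zero_divisor C_gen X)"
proof -
  obtain r where r: "r \<in> C_mod" "X = gen_class r"
    by (rule C_gen_cases[OF assms])
  have "\<exists>s\<in>X. frequent_zeros s" if "X \<notin> Units C_gen"
    using non_unit_representative[OF r(1)] that r(2) by simp
  moreover have "zero_divisor C_gen X" if "s \<in> X" "frequent_zeros s" for s
    using frequent_zeros_zero_divisor[of s] gen_class_memD[OF r(1), of s] that r(2) by simp
  moreover have "X \<notin> Units C_gen" if "zero_divisor C_gen X"
    using zero_divisor_not_Unit[OF cring_C_gen that] .
  ultimately show ?thesis
    unfolding frequent_zeros_def[symmetric] by blast
qed

end
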